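(* Let $m\ge 0$ be an integer. Let $A=(a_{ij})$, $B=(b_{ij})$, $C=(c_{ij})$, $D=(d_{ij})$ be $(2m+1)\times(2m+1)$ arrays with rows and columns indexed by $i,j\in\{0,1,\ldots,2m\}$ and entries in $\mathbb{Z}_{4m+2}$ given by $a_{ij}=2(i+j)$, $b_{ij}=c_{ij}=2(i+j)+1$, $d_{ij}=2(i+j)+2$ (all modulo $4m+2$), and let $M_{4m+2}$ be the Latin square of order $4m+2$ formed as the block array $\begin{pmatrix}A&B\\C&D\end{pmatrix}$. Let $M^*_{4m+2}$ be obtained from $M_{4m+2}$ by redefining the four entries $a_{00}=2m+1$, $d_{mm}=2m+1$, $b_{0m}=0$, $c_{m0}=0$. Then $M^*_{4m+2}$ is a near-omniversal Latin square. Moreover, for $m\ge 1$, $M^*_{4m+2}$ has no maximal partial transversal of length $2m+1$.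
   Context: Latin squares are viewed as sets of triples $(r,c,s)$ with $s$ the symbol in cell $(r,c)$. A partial transversal is a set of triples containing at most one triple in each row, at most one in each column, and at most one with each symbol; its length is its number of triples. It is maximal if not contained in a longer partial transversal. A Latin square of order $n$ is near-omniversal if there is exactly one integer $\ell$ with $\lceil n/2\rceil\le\ell\le n$ for which it has no maximal partial transversal of length $\ell$. *)

theory Defs
  imports Complex_Main
begin

text \<open>
  A Latin square of order \<open>n\<close> is a set of triples (row, column, symbol). Rows, columns and
  symbols are all indexed by \<open>{..<n}\<close>; as a symbol, \<open>k < n\<close> stands for its residue class modulo \<open>n\<close>.
\<close>

type_synonym triple = "nat \<times> nat \<times> nat"

fun row :: "triple \<Rightarrow> nat" where "row (r, c, s) = r"
fun col :: "triple \<Rightarrow> nat" where "col (r, c, s) = c"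
fun symb :: "triple \<Rightarrow> nat" where "symb (r, c, s) = s"

definition latin_square :: "nat \<Rightarrow> triple set \<Rightarrow> bool" where
  "latin_square n L \<longleftrightarrow>
     L \<subseteq> {..<n} \<times> {..<n} \<times> {..<n} \<and>
     (\<forall>r<n. \<forall>c<n. \<exists>!s. (r, c, s) \<in> L) \<and>
     (\<forall>r<n. \<forall>s<n. \<exists>!c. (r, c, s) \<in> L) \<and>
     (\<forall>c<n. \<forall>s<n. \<exists>!r. (r, c, s) \<in> L)"

definition partial_transversal :: "triple set \<Rightarrow> triple set \<Rightarrow> bool" where
  "partial_transversal L T \<longleftrightarrow> T \<subseteq> L \<and> inj_on row T \<and> inj_on col T \<and> inj_on symb T"

definition maximal_partial_transversal :: "triple set \<Rightarrow> triple set \<Rightarrow> bool" where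
  "maximal_partial_transversal L T \<longleftrightarrow>
     partial_transversal L T \<and>
     \<not> (\<exists>T'. partial_transversal L T' \<and> T \<subseteq> T' \<and> card T < card T')"

definition has_maximal_of_length :: "triple set \<Rightarrow> nat \<Rightarrow> bool" where
  "has_maximal_of_length L l \<longleftrightarrow> (\<exists>T. maximal_partial_transversal L T \<and> card T = l)"

definition near_omniversal :: "nat \<Rightarrow> triple set \<Rightarrow> bool" where
  "near_omniversal n L \<longleftrightarrow>
     latin_square n L \<and>
     (\<exists>!l::nat. \<lceil>real n / 2\<rceil> \<le> int l \<and> l \<le> n \<and> \<not> has_maximal_of_length L l)"

definition square_of_array :: "nat \<Rightarrow> (nat \<Rightarrow> nat \<Rightarrow> nat) \<Rightarrow> triple set" where
  "square_of_array n X = {(r, c, X r c) | r c. r < n \<and> c < n}"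

definition block_array ::
  "nat \<Rightarrow> (nat \<Rightarrow> nat \<Rightarrow> nat) \<Rightarrow> (nat \<Rightarrow> nat \<Rightarrow> nat) \<Rightarrow> (nat \<Rightarrow> nat \<Rightarrow> nat) \<Rightarrow> (nat \<Rightarrow> nat \<Rightarrow> nat) \<Rightarrow>
   nat \<Rightarrow> nat \<Rightarrow> nat" where
  "block_array k A B C D r c =
     (if r < k then (if c < k then A r c else B r (c - k))
      else (if c < k then C (r - k) c else D (r - k) (c - k)))"

definition redefine_entry ::
  "(nat \<Rightarrow> nat \<Rightarrow> nat) \<Rightarrow> nat \<Rightarrow> nat \<Rightarrow> nat \<Rightarrow> nat \<Rightarrow> nat \<Rightarrow> nat" where
  "redefine_entry X i j s = X(i := (X i)(j := s))"

definition block_a :: "nat \<Rightarrow> nat \<Rightarrow> nat \<Rightarrow> nat" where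
  "block_a m i j = (2 * (i + j)) mod (4 * m + 2)"

definition block_b :: "nat \<Rightarrow> nat \<Rightarrow> nat \<Rightarrow> nat" where
  "block_b m i j = (2 * (i + j) + 1) mod (4 * m + 2)"

definition block_c :: "nat \<Rightarrow> nat \<Rightarrow> nat \<Rightarrow> nat" where
  "block_c m i j = (2 * (i + j) + 1) mod (4 * m + 2)"

definition block_d :: "nat \<Rightarrow> nat \<Rightarrow> nat \<Rightarrow> nat" where
  "block_d m i j = (2 * (i + j) + 2) mod (4 * m + 2)"

definition M_array :: "nat \<Rightarrow> nat \<Rightarrow> nat \<Rightarrow> nat" where
  "M_array m = block_array (2 * m + 1) (block_a m) (block_b m) (block_c m) (block_d m)"

text \<open>
  In the coordinates of the whole array, position \<open>(i, j)\<close> of the block \<open>B\<close>, \<open>C\<close> or \<open>D\<close> is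
  offset by \<open>2 * m + 1\<close> in the column, in the row, or in both; so the entries redefined below
  are those called $a_{00}$, $d_{mm}$, $b_{0m}$ and $c_{m0}$.
\<close>

definition M_star_array :: "nat \<Rightarrow> nat \<Rightarrow> nat \<Rightarrow> nat" where
  "M_star_array m = (let k = 2 * m + 1 in
     redefine_entry (redefine_entry (redefine_entry (redefine_entry (M_array m)
       0 0 (2 * m + 1))
       (k + m) (k + m) (2 * m + 1))
       0 (k + m) 0)
       (k + m) 0 0)"

definition M_star :: "nat \<Rightarrow> triple set" where
  "M_star m = square_of_array (4 * m + 2) (M_star_array m)"

end

theory Submission
  imports Defs "HOL-Number_Theory.Cong"
begin

text \<open>
  Put \<open>k = 2 * m + 1\<close>. Permuting rows and columns turns \<open>M\<close> into the addition table of the integers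
  modulo \<open>2 * k\<close>, and the four redefined entries switch the intercalate on rows and columns \<open>0, k\<close>.

  A maximal partial transversal of length \<open>k\<close> leaves \<open>k\<close> unused columns whose symbols in any row
  form either the set of used symbols or its complement. Comparing the unswitched rows 1 and 2, the
  unused columns must be all the even or all the odd ones; then the symbols of row 0 on them have
  mixed parity, unlike those of row 2.

  For a longer length, leave unused only even rows, even columns and odd symbols: since a sum of
  even numbers is even, such a partial transversal is maximal. Summing symbol minus row minus column
  shows that one switched entry has to be used exactly when the length is even.
\<close>

section \<open>Maximality tested one cell at a time, and its invariance under permuting rows and
  columns\<close>

text \<open>A triple of a larger partial transversal that lies outside \<open>T\<close> differs from
  \<open>T\<close> in all three coordinates, by injectivity. So failure of maximality already shows
  in one addable triple; finiteness makes adding it raise \<open>card\<close>.\<close>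

lemma maximal_partial_transversal_iff:
  assumes "finite L"
  shows "maximal_partial_transversal L T \<longleftrightarrow> partial_transversal L T \<and>
    (\<forall>t\<in>L. row t \<in> row ` T \<or> col t \<in> col ` T \<or> symb t \<in> symb ` T)"
proof (intro iffI conjI)
  assume max: "maximal_partial_transversal L T"
  then show pt: "partial_transversal L T"
    by (simp add: maximal_partial_transversal_def)
  have fin: "finite T"
    using pt assms finite_subset by (auto simp: partial_transversal_def)
  show "\<forall>t\<in>L. row t \<in> row ` T \<or> col t \<in> col ` T \<or> symb t \<in> symb ` T"
  proof (rule ballI, rule ccontr)
    fix t assume t: "t \<in> L"
      and new: "\<not> (row t \<in> row ` T \<or> col t \<in> col ` T \<or> symb t \<in> symb ` T)"
    then have "partial_transversal L (insert t T)"
      using pt by (auto simp: partial_transversal_def)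
    moreover have "t \<notin> T" using new by blast
    then have "card T < card (insert t T)" using fin by simp
    ultimately show False
      using max by (auto simp: maximal_partial_transversal_def)
  qed
next
  assume *: "partial_transversal L T \<and>
    (\<forall>t\<in>L. row t \<in> row ` T \<or> col t \<in> col ` T \<or> symb t \<in> symb ` T)"
  have False if T': "partial_transversal L T'" "T \<subseteq> T'" "card T < card T'" for T'
  proof -
    from that obtain t where t: "t \<in> T'" "t \<notin> T" by (metis less_irrefl subsetI subset_antisym)
    then have "t \<in> L" using T' by (auto simp: partial_transversal_def)
    moreover have "f t \<notin> f ` T" if "inj_on f T'" for f :: "triple \<Rightarrow> nat"
      using inj_on_image_mem_iff[OF that] t T'(2) by simp
    ultimately show False
      using * T'(1) unfolding partial_transversal_def by blast
  qed
  then show "maximal_partial_transversal L T"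
    using * by (auto simp: maximal_partial_transversal_def)
qed

text \<open>The array makes the symbol a function of the cell, so cells alone encode a partial
  transversal. The last clause is the one-triple criterion for maximality.\<close>

definition maximal_cells :: "nat \<Rightarrow> (nat \<Rightarrow> nat \<Rightarrow> nat) \<Rightarrow> (nat \<times> nat) set \<Rightarrow> bool" where
  "maximal_cells n X I \<longleftrightarrow>
     I \<subseteq> {..<n} \<times> {..<n} \<and> inj_on fst I \<and> inj_on snd I \<and> inj_on (case_prod X) I \<and>
     (\<forall>r<n. \<forall>c<n. r \<notin> fst ` I \<longrightarrow> c \<notin> snd ` I \<longrightarrow> X r c \<in> case_prod X ` I)"

lemma has_maximal_of_length_iff_maximal_cells:
  "has_maximal_of_length (square_of_array n X) l \<longleftrightarrow> (\<exists>I. maximal_cells n X I \<and> card I = l)"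
proof -
  define e where "e = (\<lambda>(r, c). (r, c, X r c))"
  have L: "square_of_array n X = e ` ({..<n} \<times> {..<n})"
    by (auto simp: square_of_array_def e_def)
  have comp: "row (e p) = fst p" "col (e p) = snd p" "symb (e p) = case_prod X p" for p
    by (auto simp: e_def split: prod.split)
  have inj: "inj_on e I" for I by (auto simp: e_def inj_on_def)
  have img: "row ` e ` I = fst ` I" "col ` e ` I = snd ` I" "symb ` e ` I = case_prod X ` I" for I
    by (simp_all add: image_image comp)
  have inj_iff: "inj_on row (e ` I) \<longleftrightarrow> inj_on fst I" "inj_on col (e ` I) \<longleftrightarrow> inj_on snd I"
    "inj_on symb (e ` I) \<longleftrightarrow> inj_on (case_prod X) I" for I
    unfolding comp_inj_on_iff[OF inj] by (simp_all add: o_def comp)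
  have sub: "e ` I \<subseteq> e ` J \<longleftrightarrow> I \<subseteq> J" for I J
    using inj[of UNIV] by (simp add: inj_image_subset_iff)
  have iff: "maximal_partial_transversal (square_of_array n X) (e ` I) \<longleftrightarrow> maximal_cells n X I" for I
    unfolding L
    by (subst maximal_partial_transversal_iff)
      (auto simp: partial_transversal_def maximal_cells_def sub inj_iff img comp)
  show ?thesis
  proof
    assume "has_maximal_of_length (square_of_array n X) l"
    then obtain T where T: "maximal_partial_transversal (square_of_array n X) T" "card T = l"
      by (auto simp: has_maximal_of_length_def)
    then have "T \<subseteq> e ` ({..<n} \<times> {..<n})"
      by (auto simp: maximal_partial_transversal_def partial_transversal_def L)
    then obtain I where "T = e ` I" by (auto simp: subset_image_iff)
    with T show "\<exists>I. maximal_cells n X I \<and> card I = l"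
      using iff card_image[OF inj] by auto
  next
    assume "\<exists>I. maximal_cells n X I \<and> card I = l"
    then show "has_maximal_of_length (square_of_array n X) l"
      using iff card_image[OF inj] by (auto simp: has_maximal_of_length_def)
  qed
qed

lemma maximal_cells_isotopic:
  assumes X: "\<And>r c. r < n \<Longrightarrow> c < n \<Longrightarrow> X r c = Q (\<rho> r) (\<gamma> c)"
    and \<rho>: "bij_betw \<rho> {..<n} {..<n}" and \<gamma>: "bij_betw \<gamma> {..<n} {..<n}"
    and I: "maximal_cells n X I"
  shows "\<exists>J. maximal_cells n Q J \<and> card J = card I"
proof -
  let ?f = "map_prod \<rho> \<gamma>"
  have sub: "I \<subseteq> {..<n} \<times> {..<n}" using I by (simp add: maximal_cells_def)
  have inj: "inj_on ?f I"
    using inj_on_subset[OF map_prod_inj_on[OF bij_betw_imp_inj_on[OF \<rho>] bij_betw_imp_inj_on[OF \<gamma>]] sub] .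
  have lt: "\<rho> r < n" "\<gamma> r < n" if "r < n" for r
    using that bij_betwE[OF \<rho>] bij_betwE[OF \<gamma>] by auto
  have Xp: "case_prod Q (?f p) = case_prod X p" if "p \<in> I" for p
    using that sub X by (auto simp: case_prod_beta)
  have "maximal_cells n Q (?f ` I)"
    unfolding maximal_cells_def
  proof (intro conjI allI impI)
    show "?f ` I \<subseteq> {..<n} \<times> {..<n}" using sub lt by auto
    have "inj_on (\<rho> \<circ> fst) I"
      using I sub by (intro comp_inj_on inj_on_subset[OF bij_betw_imp_inj_on[OF \<rho>]])
        (auto simp: maximal_cells_def)
    then show "inj_on fst (?f ` I)"
      by (intro inj_on_imageI) (simp add: o_def)
    have "inj_on (\<gamma> \<circ> snd) I"
      using I sub by (intro comp_inj_on inj_on_subset[OF bij_betw_imp_inj_on[OF \<gamma>]])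
        (auto simp: maximal_cells_def)
    then show "inj_on snd (?f ` I)"
      by (intro inj_on_imageI) (simp add: o_def)
    have "inj_on (\<lambda>p. case_prod Q (?f p)) I"
      using I Xp by (simp add: maximal_cells_def cong: inj_on_cong)
    then show "inj_on (case_prod Q) (?f ` I)"
      by (intro inj_on_imageI) (simp add: o_def)
    fix x y assume xy: "x < n" "y < n" "x \<notin> fst ` ?f ` I" "y \<notin> snd ` ?f ` I"
    obtain r where r: "r < n" "x = \<rho> r"
      using xy bij_betw_imp_surj_on[OF \<rho>] by (metis imageE lessThan_iff)
    obtain c where c: "c < n" "y = \<gamma> c"
      using xy bij_betw_imp_surj_on[OF \<gamma>] by (metis imageE lessThan_iff)
    have "r \<notin> fst ` I" "c \<notin> snd ` I" using xy r c by force+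
    then have "X r c \<in> case_prod X ` I" using I r c by (auto simp: maximal_cells_def)
    then show "Q x y \<in> case_prod Q ` ?f ` I"
      unfolding image_image using X r c Xp by (simp cong: image_cong_simp)
  qed
  then show ?thesis using card_image[OF inj] by blast
qed

text \<open>The converse transport uses the inverse permutations. Symbols are not renamed:
  reordering rows and columns is enough to bring \<open>M_star\<close> into cyclic form.\<close>

lemma has_maximal_of_length_isotopic:
  assumes X: "\<And>r c. r < n \<Longrightarrow> c < n \<Longrightarrow> X r c = Q (\<rho> r) (\<gamma> c)"
    and \<rho>: "bij_betw \<rho> {..<n} {..<n}" and \<gamma>: "bij_betw \<gamma> {..<n} {..<n}"
  shows "has_maximal_of_length (square_of_array n X) l \<longleftrightarrow> (\<exists>J. maximal_cells n Q J \<and> card J = l)"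
proof -
  let ?r = "inv_into {..<n} \<rho>" and ?c = "inv_into {..<n} \<gamma>"
  have "Q x y = X (?r x) (?c y)" if "x < n" "y < n" for x y
  proof -
    have "?r x \<in> {..<n}" "?c y \<in> {..<n}"
      using that \<rho> \<gamma> by (metis bij_betw_imp_surj_on inv_into_into lessThan_iff)+
    moreover have "\<rho> (?r x) = x" "\<gamma> (?c y) = y"
      using that \<rho> \<gamma> by (simp_all add: bij_betw_inv_into_right)
    ultimately show ?thesis using X by simp
  qed
  then have "\<exists>J. maximal_cells n X J \<and> card J = card I" if "maximal_cells n Q I" for I
    using maximal_cells_isotopic[where X = Q and Q = X, OF _ bij_betw_inv_into[OF \<rho>] bij_betw_inv_into[OF \<gamma>]]
      that by blast
  moreover have "\<exists>J. maximal_cells n Q J \<and> card J = card I" if "maximal_cells n X I" for I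
    using maximal_cells_isotopic[where X = X and Q = Q, OF _ \<rho> \<gamma>] X that by blast
  ultimately show ?thesis
    unfolding has_maximal_of_length_iff_maximal_cells by metis
qed

lemma latin_square_of_array:
  assumes lt: "\<And>r c. r < n \<Longrightarrow> c < n \<Longrightarrow> X r c < n"
    and row: "\<And>r. r < n \<Longrightarrow> inj_on (X r) {..<n}"
    and col: "\<And>c. c < n \<Longrightarrow> inj_on (\<lambda>r. X r c) {..<n}"
  shows "latin_square n (square_of_array n X)"
proof -
  have surj: "f ` {..<n} = {..<n}" if "inj_on f {..<n}" "\<And>i. i < n \<Longrightarrow> f i < n" for f :: "nat \<Rightarrow> nat"
    using that by (intro endo_inj_surj) auto
  have "\<exists>!c. (r, c, s) \<in> square_of_array n X" if "r < n" "s < n" for r s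
  proof -
    have "s \<in> X r ` {..<n}" using surj[OF row] lt that by simp
    then show ?thesis
      using row[OF that(1)] that by (auto simp: square_of_array_def inj_on_def)
  qed
  moreover have "\<exists>!r. (r, c, s) \<in> square_of_array n X" if "c < n" "s < n" for c s
  proof -
    have "s \<in> (\<lambda>r. X r c) ` {..<n}" using surj[OF col] lt that by simp
    then show ?thesis
      using col[OF that(1)] that by (auto simp: square_of_array_def inj_on_def)
  qed
  moreover have "\<exists>!s. (r, c, s) \<in> square_of_array n X" if "r < n" "c < n" for r c
    using that by (auto simp: square_of_array_def)
  ultimately show ?thesis
    using lt by (auto simp: latin_square_def square_of_array_def)
qed

section \<open>The switched cyclic square and its identification with \<open>M_star\<close>\<close>

text \<open>Unswitched, the four cells in rows and columns \<open>0\<close>, \<open>k\<close> carry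
  only the symbols \<open>0\<close> and \<open>k\<close>, each once per row and column. Adding
  \<open>k\<close> swaps these two symbols.\<close>

definition switched_cyclic :: "nat \<Rightarrow> nat \<Rightarrow> nat \<Rightarrow> nat" where
  "switched_cyclic k x y =
     (if x \<in> {0, k} \<and> y \<in> {0, k} then (x + y + k) mod (2 * k) else (x + y) mod (2 * k))"

text \<open>
  Row or column \<open>i\<close> of the first half is sent to the residue \<open>2 * i\<close>, of the second half to
  \<open>2 * i + 1\<close>; the entry of \<open>M\<close> is then the sum of the two residues.
\<close>

definition unblock :: "nat \<Rightarrow> nat \<Rightarrow> nat" where
  "unblock k r = (if r < k then 2 * r else 2 * (r - k) + 1)"

lemma bij_unblock: "bij_betw (unblock k) {..<2 * k} {..<2 * k}"
proof -
  have "inj_on (unblock k) {..<2 * k}"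
    by (auto simp: inj_on_def unblock_def split: if_splits) presburger+
  moreover have "unblock k ` {..<2 * k} \<subseteq> {..<2 * k}"
    by (auto simp: unblock_def)
  ultimately show ?thesis
    by (simp add: bij_betw_def endo_inj_surj)
qed

lemma M_star_array_eq:
  assumes "r < 4 * m + 2" "c < 4 * m + 2"
  shows "M_star_array m r c =
    switched_cyclic (2 * m + 1) (unblock (2 * m + 1) r) (unblock (2 * m + 1) c)"
proof -
  let ?k = "2 * m + 1"
  have n: "4 * m + 2 = 2 * ?k" by simp
  have M: "M_array m r c = (unblock ?k r + unblock ?k c) mod (2 * ?k)"
  proof -
    have d: "2 * (r - ?k + (c - ?k)) + 2 = 2 * (r - ?k) + 1 + (2 * (c - ?k) + 1)"
      and a: "2 * (r + c) = 2 * r + 2 * c"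
      and b: "2 * (r + (c - ?k)) + 1 = 2 * r + (2 * (c - ?k) + 1)"
      and c: "2 * (r - ?k + c) + 1 = 2 * (r - ?k) + 1 + 2 * c"
      by simp_all
    show ?thesis
      unfolding M_array_def block_array_def block_a_def block_b_def block_c_def block_d_def
        unblock_def n a b c d by simp
  qed
  \<comment> \<open>Index \<open>?k + m\<close> is the one sent to residue \<open>?k\<close>, so the
    redefined rows and columns \<open>0\<close> and \<open>?k + m\<close> become residues
    \<open>0\<close> and \<open>?k\<close>.\<close>
  have z: "unblock ?k q = 0 \<longleftrightarrow> q = 0" "unblock ?k q = ?k \<longleftrightarrow> q = ?k + m" for q
    by (auto simp: unblock_def split: if_splits) presburger+
  have star: "M_star_array m r c =
    (if r = 0 \<and> c = 0 \<or> r = ?k + m \<and> c = ?k + m then ?k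
     else if r = 0 \<and> c = ?k + m \<or> r = ?k + m \<and> c = 0 then 0 else M_array m r c)"
    by (auto simp: M_star_array_def redefine_entry_def Let_def)
  have three: "(?k + ?k + ?k) mod (2 * ?k) = ?k"
    by (simp add: mod_if)
  have two: "(0 + ?k + ?k) mod (2 * ?k) = 0" "(?k + 0 + ?k) mod (2 * ?k) = 0" "(0 + 0 + ?k) mod (2 * ?k) = ?k"
    by simp_all
  show ?thesis
    unfolding star switched_cyclic_def M insert_iff z using z[of r] z[of c] three two by auto
qed

lemma switched_cyclic_commute: "switched_cyclic k x y = switched_cyclic k y x"
  by (auto simp: switched_cyclic_def add.commute)

lemma switched_cyclic_less: "k > 0 \<Longrightarrow> switched_cyclic k x y < 2 * k"
  by (simp add: switched_cyclic_def)

lemma inj_on_add_mod: "inj_on (\<lambda>y. (x + y) mod n) {..<n :: nat}"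
proof (rule inj_onI)
  fix y z assume "y \<in> {..<n}" "z \<in> {..<n}" "(x + y) mod n = (x + z) mod n"
  then show "y = z"
    using cong_add_lcancel_nat[of x y z n] by (simp add: cong_def)
qed

text \<open>In row \<open>0\<close> or \<open>k\<close>, switching amounts to transposing columns
  \<open>0\<close> and \<open>k\<close> before adding; the other rows are plain
  translations.\<close>

lemma inj_on_switched_cyclic:
  assumes "k > 0"
  shows "inj_on (switched_cyclic k x) {..<2 * k}"
proof (cases "x \<in> {0, k}")
  case True
  let ?\<tau> = "\<lambda>y. if y = 0 then k else if y = k then 0 else y"
  have "switched_cyclic k x = (\<lambda>y. (x + y) mod (2 * k)) \<circ> ?\<tau>"
    using True by (auto simp: switched_cyclic_def mult_2[symmetric])
  moreover have "inj_on ((\<lambda>y. (x + y) mod (2 * k)) \<circ> ?\<tau>) {..<2 * k}"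
  proof (rule comp_inj_on)
    show "inj_on ?\<tau> {..<2 * k}" by (auto simp: inj_on_def)
    show "inj_on (\<lambda>y. (x + y) mod (2 * k)) (?\<tau> ` {..<2 * k})"
      by (rule inj_on_subset[OF inj_on_add_mod]) (use assms in auto)
  qed
  ultimately show ?thesis by (simp only:)
next
  case False
  then have "switched_cyclic k x = (\<lambda>y. (x + y) mod (2 * k))"
    by (auto simp: switched_cyclic_def)
  then show ?thesis
    using inj_on_add_mod[of x "2 * k"] by simp
qed

lemma latin_square_M_star: "latin_square (4 * m + 2) (M_star m)"
  unfolding M_star_def
proof (rule latin_square_of_array)
  let ?k = "2 * m + 1"
  have n: "4 * m + 2 = 2 * ?k" by simp
  note bij = bij_unblock[of ?k, folded n]
  note inj = inj_on_switched_cyclic[of ?k, simplified n[symmetric]]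
  have row: "inj_on (\<lambda>c. switched_cyclic ?k x (unblock ?k c)) {..<4 * m + 2}" for x
    using comp_inj_on[OF bij_betw_imp_inj_on[OF bij], of "switched_cyclic ?k x"] inj
      bij_betw_imp_surj_on[OF bij]
    by (simp add: o_def)
  show "M_star_array m r c < 4 * m + 2" if "r < 4 * m + 2" "c < 4 * m + 2" for r c
    using M_star_array_eq[OF that] switched_cyclic_less[of ?k] by (simp add: n[symmetric])
  show "inj_on (M_star_array m r) {..<4 * m + 2}" if "r < 4 * m + 2" for r
    using row[of "unblock ?k r"] M_star_array_eq[OF that]
    by (subst inj_on_cong[OF M_star_array_eq[OF that]]) simp_all
  show "inj_on (\<lambda>r. M_star_array m r c) {..<4 * m + 2}" if "c < 4 * m + 2" for c
    using row[of "unblock ?k c"]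
    by (subst inj_on_cong[OF M_star_array_eq[OF _ that]])
      (simp_all only: switched_cyclic_commute[of _ _ "unblock ?k c"] lessThan_iff)
qed

lemma has_maximal_of_length_M_star_iff:
  "has_maximal_of_length (M_star m) l \<longleftrightarrow>
     (\<exists>J. maximal_cells (4 * m + 2) (switched_cyclic (2 * m + 1)) J \<and> card J = l)"
proof -
  have n: "4 * m + 2 = 2 * (2 * m + 1)" by simp
  show ?thesis
    unfolding M_star_def
    using bij_unblock[of "2 * m + 1", folded n] M_star_array_eq
    by (intro has_maximal_of_length_isotopic
        [where \<rho> = "unblock (2 * m + 1)" and \<gamma> = "unblock (2 * m + 1)"])
qed

section \<open>No maximal partial transversal of half the order\<close>

lemma not_maximal_cells_half:
  assumes k: "odd k" "k \<ge> 3" and I: "maximal_cells (2 * k) (switched_cyclic k) I" "card I = k"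
  shows False
proof -
  let ?Q = "switched_cyclic k"
  define C where "C = {..<2 * k} - snd ` I"
  define S where "S = case_prod ?Q ` I"
  have sub: "I \<subseteq> {..<2 * k} \<times> {..<2 * k}" and inj: "inj_on fst I" "inj_on snd I" "inj_on (case_prod ?Q) I"
    and max: "\<And>x y. x < 2 * k \<Longrightarrow> y < 2 * k \<Longrightarrow> x \<notin> fst ` I \<Longrightarrow> y \<notin> snd ` I \<Longrightarrow> ?Q x y \<in> S"
    using I by (auto simp: maximal_cells_def S_def)
  have pos: "k > 0" using k by simp
  have fin: "finite I" using sub finite_subset by blast
  have C_sub: "C \<subseteq> {..<2 * k}" by (auto simp: C_def)
  have card_C: "card C = k"
    unfolding C_def using I(2) sub fin inj by (subst card_Diff_subset) (auto simp: card_image)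
  have card_S: "card S = k" using I(2) inj(3) by (simp add: S_def card_image)
  have S_sub: "S \<subseteq> {..<2 * k}" using switched_cyclic_less[OF pos] by (auto simp: S_def)
  have card_row: "card (?Q x ` C) = k" for x
    using inj_on_subset[OF inj_on_switched_cyclic[OF pos] C_sub] card_C by (simp add: card_image)
  have row_sub: "?Q x ` C \<subseteq> {..<2 * k}" for x
    using switched_cyclic_less[OF pos] by auto
  have unused_col: "(\<lambda>x. ?Q x y) ` ({..<2 * k} - fst ` I) = S" if "y \<in> C" for y
  proof (rule card_subset_eq)
    show "finite S" using fin by (simp add: S_def)
    show "(\<lambda>x. ?Q x y) ` ({..<2 * k} - fst ` I) \<subseteq> S"
      using that max by (auto simp: C_def)
    have "card ({..<2 * k} - fst ` I) = k"
      using I(2) sub fin inj by (subst card_Diff_subset) (auto simp: card_image)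
    moreover have "inj_on (\<lambda>x. ?Q x y) ({..<2 * k} - fst ` I)"
      using inj_on_switched_cyclic[OF pos, of y]
      by (subst switched_cyclic_commute) (auto intro: inj_on_subset)
    ultimately show "card ((\<lambda>x. ?Q x y) ` ({..<2 * k} - fst ` I)) = card S"
      using card_S by (simp add: card_image)
  qed
  have rows: "?Q x ` C = S \<or> ?Q x ` C = {..<2 * k} - S" if x: "x < 2 * k" for x
  proof (cases "x \<in> fst ` I")
    case False
    then have "?Q x ` C \<subseteq> S" using max x by (auto simp: C_def)
    then show ?thesis
      using card_subset_eq[of S "?Q x ` C"] card_row card_S fin by (simp add: S_def)
  next
    case True
    have "?Q x y \<notin> S" if "y \<in> C" for y
    proof (rule notI)
      assume "?Q x y \<in> S"
      then obtain x' where "x' \<in> {..<2 * k} - fst ` I" "?Q x y = ?Q x' y"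
        using unused_col[OF \<open>y \<in> C\<close>] by auto
      then show False
        using inj_onD[OF inj_on_switched_cyclic[OF pos, of y], of x x'] x True
        by (auto simp: switched_cyclic_commute[of k _ y])
    qed
    then have "?Q x ` C \<subseteq> {..<2 * k} - S" using row_sub by auto
    moreover have "card ({..<2 * k} - S) = k"
      using card_S S_sub finite_subset by (subst card_Diff_subset) auto
    ultimately show ?thesis
      using card_subset_eq[of "{..<2 * k} - S" "?Q x ` C"] card_row by simp
  qed
  \<comment> \<open>This eliminates \<open>S\<close>. Row 2 serves as the reference because it is
    unswitched: \<open>k\<close> is odd and at least 3.\<close>
  have two_rows: "?Q x ` C = ?Q 2 ` C \<or> ?Q x ` C = {..<2 * k} - ?Q 2 ` C" if "x < 2 * k" for x
    using rows[OF that] rows[of 2] S_sub k by auto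
  have Q1: "?Q 1 y = (y + 1) mod (2 * k)" and Q2: "?Q 2 y = (y + 2) mod (2 * k)" for y
    using k by (auto simp: switched_cyclic_def)
  have step: "Suc y \<in> C \<longleftrightarrow> y \<notin> C" if "Suc y < 2 * k" for y
  proof -
    let ?s = "\<lambda>y. Suc y mod (2 * k)"
    have mem: "?Q x y \<in> ?Q x ` C \<longleftrightarrow> y \<in> C" if "y < 2 * k" for x y
      using inj_on_image_mem_iff[OF inj_on_switched_cyclic[OF pos] _ C_sub] that by simp
    have shift: "?Q 1 (?s y) = ?Q 2 y" for y
      unfolding Q1 Q2 by (simp add: mod_simps)
    have succ: "?s y \<in> C \<longleftrightarrow> ?Q 2 y \<in> ?Q 1 ` C" for y
      using mem[of "?s y" 1] pos unfolding shift by simp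
    \<comment> \<open>Row 1 at column \<open>y + 1\<close> agrees with row 2 at column
      \<open>y\<close>. Equal symbol sets would close \<open>C\<close> under cyclic successor and
      make it all columns; complementary sets instead force \<open>C\<close> to alternate.\<close>
    have "?Q 1 ` C \<noteq> ?Q 2 ` C"
    proof
      assume eq: "?Q 1 ` C = ?Q 2 ` C"
      have closed: "?s y \<in> C" if "y \<in> C" for y
        unfolding succ eq using that by blast
      obtain y\<^sub>0 where y\<^sub>0: "y\<^sub>0 \<in> C" using card_C pos by (metis card.empty ex_in_conv less_irrefl)
      have reach: "(y\<^sub>0 + j) mod (2 * k) \<in> C" for j
      proof (induction j)
        case 0
        then show ?case using y\<^sub>0 C_sub by auto
      next
        case (Suc j)
        then show ?case using closed[OF Suc] by (simp add: mod_simps)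
      qed
      have "z \<in> C" if "z < 2 * k" for z
      proof -
        have "y\<^sub>0 < 2 * k" using y\<^sub>0 C_sub by auto
        then have "y\<^sub>0 + (2 * k - y\<^sub>0 + z) = z + 2 * k" by simp
        then show ?thesis using reach[of "2 * k - y\<^sub>0 + z"] that by simp
      qed
      then have "C = {..<2 * k}" using C_sub by auto
      then show False using card_C pos by simp
    qed
    then have "?Q 1 ` C = {..<2 * k} - ?Q 2 ` C"
      using two_rows[of 1] k by auto
    then show ?thesis
      using succ[of y] mem[of y 2] that switched_cyclic_less[OF pos] by simp
  qed
  have parity: "y \<in> C \<longleftrightarrow> (even y \<longleftrightarrow> 0 \<in> C)" if "y < 2 * k" for y
    using that by (induction y) (use step in auto)
  have even_iff: "even (?Q 2 y) \<longleftrightarrow> even y" for y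
    unfolding Q2 by (simp add: even_mod_2_iff dvd_mod_iff)
  have par2: "z \<in> ?Q 2 ` C \<Longrightarrow> even z \<longleftrightarrow> 0 \<in> C" for z
    using even_iff parity C_sub by (metis imageE lessThan_iff subsetD)
  show False
  proof (cases "0 \<in> C")
    case True
    \<comment> \<open>On the even columns row 2 shows only even symbols. Row 0 shares the symbol 2
      with it but also shows the odd symbol \<open>k\<close>, so the two sets are neither equal nor
      complementary.\<close>
    have "2 \<in> C" using parity[of 2] True k by simp
    then have "?Q 0 2 \<in> ?Q 0 ` C" "?Q 0 0 \<in> ?Q 0 ` C" "?Q 2 0 \<in> ?Q 2 ` C" using True by blast+
    moreover have "?Q 0 2 = 2" "?Q 0 0 = k" "?Q 2 0 = 2"
      using k by (auto simp: switched_cyclic_def)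
    ultimately have "2 \<in> ?Q 0 ` C" "k \<in> ?Q 0 ` C" "2 \<in> ?Q 2 ` C" by metis+
    then show False using two_rows[of 0] par2[of k] True k by auto
  next
    case False
    \<comment> \<open>On the odd columns the parities are reversed: row 0 shares the symbol 1 with
      row 2, while its switched cell in column \<open>k\<close> shows 0.\<close>
    have "1 \<in> C" "k \<in> C" "2 * k - 1 \<in> C"
      using parity[of 1] parity[of k] parity[of "2 * k - 1"] False k by simp_all
    then have "?Q 0 1 \<in> ?Q 0 ` C" "?Q 0 k \<in> ?Q 0 ` C" "?Q 2 (2 * k - 1) \<in> ?Q 2 ` C" by blast+
    moreover have "?Q 0 1 = 1" "?Q 0 k = 0" "?Q 2 (2 * k - 1) = 1"
      using k by (auto simp: switched_cyclic_def mod_if)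
    ultimately have "1 \<in> ?Q 0 ` C" "0 \<in> ?Q 0 ` C" "1 \<in> ?Q 2 ` C" by metis+
    then show False using two_rows[of 0] par2[of 0] False k by auto
  qed
qed

section \<open>A family of cells covering all even symbols, and its translates\<close>

text \<open>
  The cells \<open>(x, used_col a x)\<close> below form four arithmetic progressions of step \<open>2\<close> along diagonals.
  The cells with \<open>even x \<longleftrightarrow> x < 2 * a\<close> carry the symbols \<open>4 * i + 2\<close> with \<open>i < k\<close>, which are all the even
  residues because \<open>k\<close> is odd; the others carry the odd numbers strictly between \<open>2 * a\<close> and \<open>6 * a\<close>,
  an interval shorter than \<open>2 * k\<close>. A translation moves the cells away from the switched intercalate.
\<close>

definition used_rows :: "nat \<Rightarrow> nat \<Rightarrow> nat set" where
  "used_rows k a = {x. x < 2 * k \<and> (odd x \<or> x < 4 * a)}"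

definition used_col :: "nat \<Rightarrow> nat \<Rightarrow> nat" where
  "used_col a x =
     (if even x then if x < 2 * a then x + 2 else x + 1 - 2 * a
      else if x < 2 * a then x + 2 * a + 1 else x)"

lemma card_used_rows:
  assumes "2 * a < k"
  shows "card (used_rows k a) = k + 2 * a"
proof -
  have eq: "used_rows k a = (\<lambda>i. 2 * i + 1) ` {..<k} \<union> (\<lambda>i. 2 * i) ` {..<2 * a}" (is "_ = ?A \<union> ?B")
  proof (rule set_eqI)
    fix x
    have "x \<in> ?A \<longleftrightarrow> odd x \<and> x < 2 * k" "x \<in> ?B \<longleftrightarrow> even x \<and> x < 4 * a"
      by (auto elim!: oddE evenE) presburger+
    then show "x \<in> used_rows k a \<longleftrightarrow> x \<in> ?A \<union> ?B"
      using assms by (auto simp: used_rows_def)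
  qed
  have "card (?A \<union> ?B) = card ?A + card ?B"
    by (rule card_Un_disjoint) (auto, presburger)
  also have "card ?A = k" by (subst card_image) (auto simp: inj_on_def)
  also have "card ?B = 2 * a" by (subst card_image) (auto simp: inj_on_def)
  finally show ?thesis by (simp add: eq)
qed

lemma used_col_less:
  assumes "2 * a < k" "x \<in> used_rows k a"
  shows "used_col a x < 2 * k"
  using assms by (auto simp: used_rows_def used_col_def)

text \<open>The four branches fill disjoint column ranges: even from 2 to \<open>2 * a\<close>, even
  from \<open>2 * a + 2\<close> to \<open>4 * a\<close>, odd below \<open>2 * a\<close>, odd above
  \<open>2 * a\<close>. Hence a column reveals its branch, and the branch is inverted
  explicitly.\<close>

lemma inj_on_used_col: "inj_on (used_col a) (used_rows k a)"
proof (rule inj_on_inverseI)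
  fix x assume "x \<in> used_rows k a"
  then show "(\<lambda>y. if even y then if y \<le> 2 * a then y - 2 else y - 2 * a - 1
      else if y < 2 * a then y + 2 * a - 1 else y) (used_col a x) = x"
    unfolding used_rows_def used_col_def by (cases "x < 2 * a"; cases "even x") auto
qed

lemma even_used_col:
  assumes "x \<in> used_rows k a" "even (used_col a x)"
  shows "2 \<le> used_col a x" "used_col a x \<le> 4 * a"
  using assms by (auto simp: used_rows_def used_col_def split: if_splits)

lemma odd_used_col_surj:
  assumes "odd y" "y < 2 * k" "2 * a < k"
  obtains x where "x \<in> used_rows k a" "used_col a x = y"
proof (cases "y < 2 * a")
  case True
  with assms have "y + 2 * a - 1 \<in> used_rows k a" "used_col a (y + 2 * a - 1) = y"
    by (auto simp: used_rows_def used_col_def elim!: oddE)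
  then show thesis by (rule that)
next
  case False
  with assms have "y \<in> used_rows k a" "used_col a y = y"
    by (auto simp: used_rows_def used_col_def)
  then show thesis by (rule that)
qed

lemma even_add_used_col_iff:
  "even (x + used_col a x) \<longleftrightarrow> (even x \<longleftrightarrow> x < 2 * a)"
  by (auto simp: used_col_def)

lemma add_used_col_even:
  assumes "even x \<longleftrightarrow> x < 2 * a"
  shows "x + used_col a x = 4 * (x div 2) + 2"
  using assms by (cases "even x") (auto simp: used_col_def elim!: evenE oddE)

lemma add_used_col_odd:
  assumes "x \<in> used_rows k a" "odd (x + used_col a x)"
  shows "2 * a < x + used_col a x" "x + used_col a x < 6 * a"
  using assms by (auto simp: used_rows_def used_col_def split: if_splits elim!: evenE oddE)

lemma cong_imp_eq_nat:
  fixes u v :: nat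
  assumes "[u = v] (mod n)" "u < v + n" "v < u + n"
  shows "u = v"
  using assms
proof (induction u v rule: linorder_wlog)
  case (le u v)
  then have "n dvd v - u" by (metis cong_altdef_nat cong_sym)
  then show ?case using le by (auto dest: dvd_imp_le)
next
  case (sym u v)
  then show ?case by (metis cong_sym)
qed

text \<open>4 is not invertible modulo \<open>2 * k\<close>, but it is modulo the odd number
  \<open>k\<close>, and \<open>i\<close>, \<open>j\<close> are below \<open>k\<close>.\<close>

lemma four_mult_cong_cancel:
  assumes k: "odd k" and "i < k" "j < k" "[4 * i + c = 4 * j + c] (mod 2 * k)"
  shows "i = (j :: nat)"
proof -
  have "[4 * i = 4 * j] (mod 2 * k)" using assms by (simp add: cong_add_rcancel_nat)
  then have "[4 * i = 4 * j] (mod k)" by (rule cong_dvd_modulus_nat) simp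
  moreover have "coprime 4 k"
    using k coprime_power_left_iff[of 2 2 k] by (simp add: coprime_left_2_iff_odd)
  ultimately have "[i = j] (mod k)" by (simp add: cong_mult_lcancel_nat)
  then show ?thesis using assms by (simp add: cong_less_modulus_unique_nat)
qed

lemma inj_on_add_used_col:
  assumes k: "odd k" and a: "2 * a < k"
  shows "inj_on (\<lambda>x. (x + used_col a x + c) mod (2 * k)) (used_rows k a)"
proof (rule inj_onI)
  fix x z
  assume x: "x \<in> used_rows k a" and z: "z \<in> used_rows k a"
    and "(x + used_col a x + c) mod (2 * k) = (z + used_col a z + c) mod (2 * k)"
  then have eq: "[x + used_col a x = z + used_col a z] (mod 2 * k)"
    by (metis cong_def cong_add_rcancel_nat)
  then have par: "even (x + used_col a x) \<longleftrightarrow> even (z + used_col a z)"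
    by (metis cong_dvd_iff cong_dvd_modulus_nat dvd_triv_left)
  show "x = z"
  proof (cases "even (x + used_col a x)")
    case True
    then have e: "even x \<longleftrightarrow> x < 2 * a" "even z \<longleftrightarrow> z < 2 * a"
      using par unfolding even_add_used_col_iff by blast+
    have "x div 2 = z div 2"
    proof (rule four_mult_cong_cancel[OF k])
      show "x div 2 < k" "z div 2 < k" using x z by (auto simp: used_rows_def)
      show "[4 * (x div 2) + 2 = 4 * (z div 2) + 2] (mod 2 * k)"
        using eq unfolding e[THEN add_used_col_even] .
    qed
    \<comment> \<open>Among cells with even symbol, \<open>x div 2\<close> decides the side of
      \<open>2 * a\<close> and thereby the parity of \<open>x\<close>.\<close>
    moreover have "x < 2 * a \<longleftrightarrow> x div 2 < a" "z < 2 * a \<longleftrightarrow> z div 2 < a" by auto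
    ultimately have "even x \<longleftrightarrow> even z" using e by simp
    then show ?thesis using \<open>x div 2 = z div 2\<close>
      by (metis bit_eq_rec)
  next
    case False
    then have o: "odd (x + used_col a x)" "odd (z + used_col a z)" using par by simp_all
    have "x + used_col a x = z + used_col a z"
      by (rule cong_imp_eq_nat[OF eq])
        (use add_used_col_odd[OF x o(1)] add_used_col_odd[OF z o(2)] a in linarith)+
    moreover have "even x \<longleftrightarrow> \<not> x < 2 * a" "even z \<longleftrightarrow> \<not> z < 2 * a"
      using o unfolding even_add_used_col_iff by blast+
    \<comment> \<open>Equal sums from the same branch give equal rows. From different branches the
      rows differ by the even number \<open>2 * a\<close> although their parities differ, which is
      absurd.\<close>
    ultimately have "x = z \<or> x = z + 2 * a \<and> (even x \<longleftrightarrow> odd z) \<or> z = x + 2 * a \<and> (even x \<longleftrightarrow> odd z)"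
      unfolding used_col_def by (cases "x < 2 * a"; cases "z < 2 * a") simp_all
    then show ?thesis by auto
  qed
qed

text \<open>Counting: the \<open>k\<close> residues of \<open>4 * i + 2\<close> are distinct and
  even, and there are only \<open>k\<close> even residues.\<close>

lemma even_residue_used:
  assumes k: "odd k" and a: "2 * a < k" and e: "even e" "e < 2 * k"
  obtains x where "x \<in> used_rows k a" "(x + used_col a x) mod (2 * k) = e"
proof -
  let ?f = "\<lambda>i. (4 * i + 2) mod (2 * k)" and ?E = "(\<lambda>i. 2 * i) ` {..<k}"
  have "?f ` {..<k} = ?E"
  proof (rule card_subset_eq)
    show "?f ` {..<k} \<subseteq> ?E"
    proof
      fix y assume "y \<in> ?f ` {..<k}"
      then have "even y" "y < 2 * k" using k by (auto simp: dvd_mod_iff odd_pos)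
      then show "y \<in> ?E" by (auto elim!: evenE)
    qed
    have "inj_on ?f {..<k}"
      using four_mult_cong_cancel[OF k, where c = 2] unfolding inj_on_def cong_def by blast
    then show "card (?f ` {..<k}) = card ?E"
      by (subst (1 2) card_image) (auto simp: inj_on_def)
  qed simp
  moreover have "e \<in> ?E" using e by (auto elim!: evenE)
  ultimately have "e \<in> ?f ` {..<k}" by (simp only:)
  then obtain i where i: "i < k" "(4 * i + 2) mod (2 * k) = e" by blast
  \<comment> \<open>Of the two rows with half \<open>i\<close>, this is the one whose cell has an
    even symbol.\<close>
  define x where "x = (if i < a then 2 * i else 2 * i + 1)"
  have "x \<in> used_rows k a" "even x \<longleftrightarrow> x < 2 * a" "x div 2 = i"
    using i a by (auto simp: x_def used_rows_def)
  then show thesis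
    using that[of x] i add_used_col_even by simp
qed

text \<open>Even translations modulo an even number respect parity, so parity arguments survive
  moving the cells.\<close>

lemma shift_preimage:
  fixes r s n :: nat
  assumes "r < n" "even n" "even s"
  obtains x where "x < n" "(x + s) mod n = r" "even x \<longleftrightarrow> even r"
proof -
  have "(\<lambda>x. (s + x) mod n) ` {..<n} = {..<n}"
    using assms inj_on_add_mod[of s n] by (intro endo_inj_surj) auto
  then obtain x where x: "x < n" "(x + s) mod n = r"
    using assms(1) by (metis (no_types, lifting) add.commute imageE lessThan_iff)
  have "even ((x + s) mod n) \<longleftrightarrow> even x"
    using assms by (simp add: dvd_mod_iff)
  with x that show thesis by simp
qed

definition shifted_cells :: "nat \<Rightarrow> nat \<Rightarrow> nat \<Rightarrow> nat \<Rightarrow> (nat \<times> nat) set" where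
  "shifted_cells k a \<alpha> \<beta> =
     (\<lambda>x. ((x + \<alpha>) mod (2 * k), (used_col a x + \<beta>) mod (2 * k))) ` used_rows k a"

text \<open>For the last claim: all odd rows and columns are used, so \<open>r\<close> and
  \<open>c\<close> are even. As \<open>k\<close> is odd, \<open>(0, 0)\<close> is the only such cell
  of the intercalate; any other carries an even sum, and every even symbol is used. The corner
  carries the odd symbol \<open>k\<close> and is left to the callers.\<close>

lemma shifted_cells:
  assumes k: "odd k" and a: "2 * a < k" and even: "even \<alpha>" "even \<beta>"
    and unswitched: "\<forall>x\<in>used_rows k a.
      \<not> ((x + \<alpha>) mod (2 * k) \<in> {0, k} \<and> (used_col a x + \<beta>) mod (2 * k) \<in> {0, k})"
  defines "I \<equiv> shifted_cells k a \<alpha> \<beta>"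
  shows "I \<subseteq> {..<2 * k} \<times> {..<2 * k}"
    and "inj_on fst I" "inj_on snd I" "inj_on (case_prod (switched_cyclic k)) I"
    and "card I = k + 2 * a"
    and "case_prod (switched_cyclic k) ` I =
      (\<lambda>x. (x + used_col a x + (\<alpha> + \<beta>)) mod (2 * k)) ` used_rows k a"
    and "\<And>r c. \<lbrakk>r < 2 * k; c < 2 * k; r \<notin> fst ` I; c \<notin> snd ` I; (r, c) \<noteq> (0, 0)\<rbrakk> \<Longrightarrow>
      switched_cyclic k r c \<in> case_prod (switched_cyclic k) ` I"
proof -
  let ?U = "used_rows k a"
  let ?g = "\<lambda>x. ((x + \<alpha>) mod (2 * k), (used_col a x + \<beta>) mod (2 * k))"
  have pos: "k > 0" using k by (simp add: odd_pos)
  have I: "I = ?g ` ?U" by (simp add: I_def shifted_cells_def)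
  have fst: "inj_on (fst \<circ> ?g) ?U"
    using inj_on_subset[OF inj_on_add_mod[of \<alpha> "2 * k"], of ?U]
    by (auto simp: o_def add.commute used_rows_def)
  have "inj_on ((\<lambda>y. (\<beta> + y) mod (2 * k)) \<circ> used_col a) ?U"
    using used_col_less[OF a]
    by (intro comp_inj_on inj_on_used_col inj_on_subset[OF inj_on_add_mod]) auto
  then have snd: "inj_on (snd \<circ> ?g) ?U"
    by (simp add: o_def add.commute)
  have symb: "case_prod (switched_cyclic k) (?g x) = (x + used_col a x + (\<alpha> + \<beta>)) mod (2 * k)"
    if "x \<in> ?U" for x
  proof -
    have "case_prod (switched_cyclic k) (?g x)
        = ((x + \<alpha>) mod (2 * k) + (used_col a x + \<beta>) mod (2 * k)) mod (2 * k)"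
      unfolding switched_cyclic_def prod.case using bspec[OF unswitched that] by (rule if_not_P)
    also have "\<dots> = (x + used_col a x + (\<alpha> + \<beta>)) mod (2 * k)"
      unfolding mod_add_eq by (simp add: algebra_simps)
    finally show ?thesis .
  qed
  show "I \<subseteq> {..<2 * k} \<times> {..<2 * k}" using pos by (auto simp: I)
  show "inj_on fst I" using fst unfolding I by (rule inj_on_imageI)
  show "inj_on snd I" using snd unfolding I by (rule inj_on_imageI)
  have "inj_on (case_prod (switched_cyclic k) \<circ> ?g) ?U"
    by (subst inj_on_cong[where g = "\<lambda>x. (x + used_col a x + (\<alpha> + \<beta>)) mod (2 * k)"])
      (simp_all only: o_apply symb inj_on_add_used_col[OF k a])
  then show "inj_on (case_prod (switched_cyclic k)) I" unfolding I by (rule inj_on_imageI)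
  have "inj_on ?g ?U" using fst by (rule inj_on_imageI2)
  then show "card I = k + 2 * a"
    unfolding I using a by (simp add: card_image card_used_rows)
  show img: "case_prod (switched_cyclic k) ` I =
      (\<lambda>x. (x + used_col a x + (\<alpha> + \<beta>)) mod (2 * k)) ` ?U"
    unfolding I image_image using symb by (rule image_cong[OF refl])
  fix r c assume rc: "r < 2 * k" "c < 2 * k" "r \<notin> fst ` I" "c \<notin> snd ` I" "(r, c) \<noteq> (0, 0)"
  have "even r"
  proof (rule ccontr)
    assume "odd r"
    with rc even obtain x where "x < 2 * k" "(x + \<alpha>) mod (2 * k) = r" "odd x"
      using shift_preimage[of r "2 * k" \<alpha>] by auto
    then have "r \<in> fst ` I" by (force simp: I used_rows_def)
    with rc show False by simp
  qed
  have "even c"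
  proof (rule ccontr)
    assume "odd c"
    with rc even obtain y where y: "y < 2 * k" "(y + \<beta>) mod (2 * k) = c" "odd y"
      using shift_preimage[of c "2 * k" \<beta>] by auto
    then obtain x where "x \<in> ?U" "used_col a x = y"
      using odd_used_col_surj a by metis
    then have "c \<in> snd ` I" using y by (force simp: I)
    with rc show False by simp
  qed
  have "\<not> (r \<in> {0, k} \<and> c \<in> {0, k})"
    using \<open>even r\<close> \<open>even c\<close> k rc(5) by auto
  then have Q: "switched_cyclic k r c = (r + c) mod (2 * k)"
    unfolding switched_cyclic_def by (rule if_not_P)
  have "even ((r + c) mod (2 * k))" "(r + c) mod (2 * k) < 2 * k"
    using \<open>even r\<close> \<open>even c\<close> pos by (simp_all add: dvd_mod_iff)
  then obtain e where e: "e < 2 * k" "(e + (\<alpha> + \<beta>)) mod (2 * k) = (r + c) mod (2 * k)" "even e"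
    using shift_preimage[of "(r + c) mod (2 * k)" "2 * k" "\<alpha> + \<beta>"] even by auto
  obtain x where x: "x \<in> ?U" "(x + used_col a x) mod (2 * k) = e"
    using even_residue_used[OF k a e(3,1)] .
  have "(x + used_col a x + (\<alpha> + \<beta>)) mod (2 * k) = (r + c) mod (2 * k)"
    using e(2) unfolding x(2)[symmetric] by (simp only: mod_add_left_eq)
  then show "switched_cyclic k r c \<in> case_prod (switched_cyclic k) ` I"
    unfolding img Q using x(1) by (metis (no_types, lifting) imageI)
qed

lemma mod_eq_lt_twice:
  fixes v r n :: nat
  assumes "v mod n = r" "v < 2 * n"
  shows "v = r \<or> v = r + n"
proof (cases "v < n")
  case False
  then show ?thesis using assms le_mod_geq[of n v] by auto
qed (use assms in simp)

section \<open>Maximal partial transversals of every larger length\<close>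

text \<open>Since \<open>a\<close> is positive and rows are not translated, row 0 is used, so the
  exceptional corner never arises. The column shift alone avoids the intercalate.\<close>

lemma maximal_cells_odd:
  assumes "1 \<le> a" "a \<le> m"
  shows "\<exists>I. maximal_cells (4 * m + 2) (switched_cyclic (2 * m + 1)) I \<and> card I = 2 * m + 1 + 2 * a"
proof -
  let ?k = "2 * m + 1"
  let ?I = "shifted_cells ?k a 0 (2 * m)"
  have n: "4 * m + 2 = 2 * ?k" by simp
  have unsw: "\<forall>x\<in>used_rows ?k a.
    \<not> ((x + 0) mod (2 * ?k) \<in> {0, ?k} \<and> (used_col a x + 2 * m) mod (2 * ?k) \<in> {0, ?k})"
  proof (intro ballI notI, elim conjE)
    fix x assume x: "x \<in> used_rows ?k a"
      and "(x + 0) mod (2 * ?k) \<in> {0, ?k}" and y: "(used_col a x + 2 * m) mod (2 * ?k) \<in> {0, ?k}"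
    then have "x = 0 \<or> x = ?k" using x by (auto simp: used_rows_def)
    \<comment> \<open>Row 0 lands in column \<open>?k + 1\<close> and row \<open>?k\<close> in
      column \<open>4 * m + 1\<close>; for positive \<open>m\<close> neither is \<open>0\<close> or
      \<open>?k\<close>.\<close>
    then have "used_col a x + 2 * m = (if x = 0 then 2 * m + 2 else 4 * m + 1)"
      using assms by (auto simp: used_col_def)
    then show False using y assms by (auto split: if_splits)
  qed
  have "odd ?k" "2 * a < ?k" "even (0::nat)" "even (2 * m)" using assms by simp_all
  note cells = shifted_cells[OF this unsw]
  have "0 \<in> fst ` ?I"
    using assms by (force simp: shifted_cells_def used_rows_def)
  have covered: "switched_cyclic ?k r c \<in> case_prod (switched_cyclic ?k) ` ?I"
    if "r < 2 * ?k" "c < 2 * ?k" "r \<notin> fst ` ?I" "c \<notin> snd ` ?I" for r c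
  proof (rule cells(7)[OF that])
    show "(r, c) \<noteq> (0, 0)" using \<open>0 \<in> fst ` ?I\<close> that(3) by auto
  qed
  have "maximal_cells (4 * m + 2) (switched_cyclic ?k) ?I"
    unfolding maximal_cells_def n by (intro conjI allI impI cells(1-4) covered)
  then show ?thesis using cells(5) by blast
qed

lemma maximal_cells_even:
  assumes "1 \<le> m" "a \<le> m"
  shows "\<exists>I. maximal_cells (4 * m + 2) (switched_cyclic (2 * m + 1)) I \<and> card I = 2 * m + 2 + 2 * a"
proof -
  define \<beta> where "\<beta> = 4 * m - 4 * a"
  then have \<beta>: "\<beta> + 4 * a = 4 * m" "even \<beta>" using assms by simp_all
  let ?k = "2 * m + 1"
  let ?U = "used_rows ?k a" and ?Q = "case_prod (switched_cyclic (2 * m + 1))"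
  let ?I = "shifted_cells ?k a 2 \<beta>"
  have n: "4 * m + 2 = 2 * ?k" by simp
  have a: "2 * a < ?k" using assms by simp
  have row: "(x + 2) mod (2 * ?k) \<noteq> 0" if "x \<in> ?U" for x
  proof
    assume "(x + 2) mod (2 * ?k) = 0"
    then have "x = 4 * m" using mod_eq_lt_twice[of "x + 2" "2 * ?k"] that assms
      by (auto simp: used_rows_def)
    then show False using that assms by (auto simp: used_rows_def)
  qed
  have col: "(used_col a x + \<beta>) mod (2 * ?k) \<noteq> 0" if "x \<in> ?U" for x
  proof
    assume *: "(used_col a x + \<beta>) mod (2 * ?k) = 0"
    have "used_col a x + \<beta> < 2 * (2 * ?k)" using used_col_less[OF a that] \<beta> by arith
    from mod_eq_lt_twice[OF * this]
    have "used_col a x + \<beta> = 0 \<or> used_col a x + \<beta> = 4 * m + 2" by simp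
    then have "used_col a x = 0 \<or> used_col a x = 4 * a + 2" using \<beta> by arith
    then show False using even_used_col[OF that] by auto
  qed
  \<comment> \<open>The shifted odd symbols lie within distance \<open>2 * a\<close> of
    \<open>2 * ?k\<close>, hence of residue 0; as \<open>2 * a < ?k\<close>, none is
    \<open>?k\<close>.\<close>
  have symb: "(x + used_col a x + (2 + \<beta>)) mod (2 * ?k) \<noteq> ?k" if "x \<in> ?U" for x
  proof
    assume *: "(x + used_col a x + (2 + \<beta>)) mod (2 * ?k) = ?k"
    then have "odd (x + used_col a x + (2 + \<beta>))"
      by (metis dvd_mod_iff dvd_triv_left even_plus_one_iff)
    then have "odd (x + used_col a x)" using \<beta> by simp
    note bounds = add_used_col_odd[OF that this]
    have "x + used_col a x + (2 + \<beta>) < 2 * (2 * ?k)"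
      using bounds \<beta> assms by arith
    from mod_eq_lt_twice[OF * this] show False
      by (elim disjE) (use bounds \<beta> assms in arith)+
  qed
  have unsw: "\<forall>x\<in>?U.
    \<not> ((x + 2) mod (2 * ?k) \<in> {0, ?k} \<and> (used_col a x + \<beta>) mod (2 * ?k) \<in> {0, ?k})"
  proof (intro ballI notI, elim conjE)
    fix x assume x: "x \<in> ?U" and "(x + 2) mod (2 * ?k) \<in> {0, ?k}" and "(used_col a x + \<beta>) mod (2 * ?k) \<in> {0, ?k}"
    then have *: "(x + 2) mod (2 * ?k) = ?k" "(used_col a x + \<beta>) mod (2 * ?k) = ?k"
      using row[OF x] col[OF x] by blast+
    have "x + 2 = ?k"
      using mod_eq_lt_twice[OF *(1)] x assms by (auto simp: used_rows_def)
    then have "x = 2 * m - 1" "odd x" by presburger+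
    then have "used_col a x = (if a = m then 4 * m else 2 * m - 1)"
      using assms by (auto simp: used_col_def)
    moreover have "used_col a x + \<beta> < 2 * (2 * ?k)"
      using used_col_less[OF a x] \<beta>(1) by simp
    note mod_eq_lt_twice[OF *(2) this]
    \<comment> \<open>Row \<open>?k\<close> comes from \<open>x = 2 * m - 1\<close>, so only its
      column matters. For \<open>a = m\<close> it is the even number \<open>4 * m\<close>; otherwise
      reaching \<open>?k\<close> would need \<open>\<beta>\<close> to be 2 or
      \<open>4 * m + 4\<close>, but \<open>\<beta>\<close> is a multiple of 4 and at most
      \<open>4 * m\<close>.\<close>
    ultimately have "a = m \<and> (4 * m = ?k \<or> 4 * m = 3 * ?k) \<or> \<beta> = 2 \<or> \<beta> = 4 * m + 4"
      using assms \<beta> by (auto split: if_splits)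
    then show False using \<beta> by presburger
  qed
  have "odd ?k" "even (2::nat)" "even \<beta>" using \<beta> by simp_all
  note cells = shifted_cells[OF this(1) a this(2,3) unsw]
  have new: "0 \<notin> fst ` ?I" "0 \<notin> snd ` ?I" "?k \<notin> ?Q ` ?I"
    unfolding cells(6) unfolding shifted_cells_def image_image fst_conv snd_conv image_iff
    using row col symb by metis+
  have Q00: "?Q (0, 0) = ?k" by (simp add: switched_cyclic_def)
  have "maximal_cells (4 * m + 2) (switched_cyclic ?k) (insert (0, 0) ?I)"
    unfolding maximal_cells_def n
  proof (intro conjI allI impI)
    show "insert (0, 0) ?I \<subseteq> {..<2 * ?k} \<times> {..<2 * ?k}" using cells(1) by auto
    show "inj_on fst (insert (0, 0) ?I)" "inj_on snd (insert (0, 0) ?I)" "inj_on ?Q (insert (0, 0) ?I)"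
      unfolding inj_on_insert Q00 fst_conv snd_conv using cells(2-4) new by blast+
    fix r c assume "r < 2 * ?k" "c < 2 * ?k" "r \<notin> fst ` insert (0, 0) ?I" "c \<notin> snd ` insert (0, 0) ?I"
    then show "switched_cyclic ?k r c \<in> ?Q ` insert (0, 0) ?I"
      using cells(7)[of r c] by auto
  qed
  moreover have "finite ?I" by (simp add: shifted_cells_def used_rows_def)
  then have "card (insert (0, 0) ?I) = 2 * m + 2 + 2 * a"
    using new(1) cells(5) by (subst card_insert_disjoint) force+
  ultimately show ?thesis by blast
qed

section \<open>Order two and the conclusion\<close>

text \<open>For \<open>m = 0\<close> the missing length is the full order 2 instead of half of it:
  two cells sharing no row or column form a diagonal, which repeats its symbol.\<close>

lemma has_maximal_of_length_M_star_0:
  "has_maximal_of_length (M_star 0) 1" "\<not> has_maximal_of_length (M_star 0) 2"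
proof -
  have less_2: "x < 2 \<longleftrightarrow> x = 0 \<or> x = 1" for x :: nat by auto
  have iff: "has_maximal_of_length (M_star 0) l \<longleftrightarrow>
      (\<exists>J. maximal_cells 2 (switched_cyclic 1) J \<and> card J = l)" for l
    using has_maximal_of_length_M_star_iff[of 0 l] by (simp add: numeral_2_eq_2)
  have "maximal_cells 2 (switched_cyclic 1) {(0, 0)}"
    by (auto simp: maximal_cells_def switched_cyclic_def less_2)
  then show "has_maximal_of_length (M_star 0) 1"
    unfolding iff by (intro exI[of _ "{(0, 0)}"]) simp
  show "\<not> has_maximal_of_length (M_star 0) 2"
    unfolding iff
  proof (intro notI, elim exE conjE)
    fix J assume J: "maximal_cells 2 (switched_cyclic 1) J" "card J = 2"
    then obtain r c r' c' where rc: "J = {(r, c), (r', c')}" "(r, c) \<noteq> (r', c')"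
      by (auto simp: card_2_iff)
    then have "r < 2" "c < 2" "r' < 2" "c' < 2" "r \<noteq> r'" "c \<noteq> c'"
      "switched_cyclic 1 r c \<noteq> switched_cyclic 1 r' c'"
      using J(1) by (auto simp: maximal_cells_def)
    then show False
      unfolding less_2 by (auto simp: switched_cyclic_def)
  qed
qed

theorem theorem3p3:
  fixes m :: nat
  shows "near_omniversal (4 * m + 2) (M_star m) \<and>
    (m \<ge> 1 \<longrightarrow> \<not> has_maximal_of_length (M_star m) (2 * m + 1))"
proof (cases "m = 0")
  case True
  have "l = 1 \<or> l = 2" if "1 \<le> l" "l \<le> 2" for l :: nat using that by auto
  then have "\<exists>!l::nat. 1 \<le> l \<and> l \<le> 2 \<and> \<not> has_maximal_of_length (M_star 0) l"
    using has_maximal_of_length_M_star_0 by (intro ex1I[of _ 2]) auto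
  with True latin_square_M_star[of 0] show ?thesis
    by (simp add: near_omniversal_def numeral_2_eq_2)
next
  case False
  then have m: "1 \<le> m" by simp
  have none: "\<not> has_maximal_of_length (M_star m) (2 * m + 1)"
    using not_maximal_cells_half[of "2 * m + 1"] m
    by (auto simp: has_maximal_of_length_M_star_iff)
  \<comment> \<open>Even lengths run from \<open>2 * m + 2\<close> with \<open>a = 0\<close> to
    \<open>4 * m + 2\<close> with \<open>a = m\<close>; odd ones from \<open>2 * m + 3\<close> with
    \<open>a = 1\<close> to \<open>4 * m + 1\<close> with \<open>a = m\<close>.\<close>
  have some: "has_maximal_of_length (M_star m) l" if l: "2 * m + 1 < l" "l \<le> 4 * m + 2" for l
  proof (cases "even l")
    case True
    then obtain b where "l = 2 * b" by (rule evenE)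
    with l have "l = 2 * m + 2 + 2 * (b - (m + 1))" "b - (m + 1) \<le> m" by simp_all
    then show ?thesis
      using maximal_cells_even[OF m, of "b - (m + 1)"] by (simp add: has_maximal_of_length_M_star_iff)
  next
    case False
    then obtain b where "l = 2 * b + 1" by (rule oddE)
    with l have "l = 2 * m + 1 + 2 * (b - m)" "1 \<le> b - m" "b - m \<le> m" by simp_all
    then show ?thesis
      using maximal_cells_odd[of "b - m" m] by (simp add: has_maximal_of_length_M_star_iff)
  qed
  have "\<lceil>real (4 * m + 2) / 2\<rceil> = int (2 * m + 1)"
    by (simp add: field_simps ceiling_eq_iff)
  then have "\<exists>!l::nat. \<lceil>real (4 * m + 2) / 2\<rceil> \<le> int l \<and> l \<le> 4 * m + 2 \<and>
      \<not> has_maximal_of_length (M_star m) l"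
    using none some by (intro ex1I[of _ "2 * m + 1"]) (auto simp: le_less)
  then show ?thesis
    using none latin_square_M_star by (simp add: near_omniversal_def)
qed

end
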